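(* For $n\ge1$ let $g_n=g_n(x)=\sum_{v\in V(\mathcal{R}_n)}x^{\deg(v)}$ be the degree enumerator polynomial of the Fibonacci-run graph $\mathcal{R}_n$. Then for all $n\ge12$, $$g_n=xg_{n-1}+2g_{n-2}-xg_{n-3}-g_{n-4}+x(x-1)g_{n-5}-x(x^2-1)g_{n-7}-2x^2(x-1)^2g_{n-9}-x^2(x-1)^3g_{n-11}.$$
   Context: A binary string is run-constrained if every run of 1s in it is immediately followed by a run of 0s of strictly greater length (the empty string counts as run-constrained). For $n\ge1$ the Fibonacci-run graph $\mathcal{R}_n$ has vertex set $\{w\in\{0,1\}^n : w00 \text{ is run-constrained}\}$, two vertices being adjacent iff they differ in exactly one coordinate; $\deg(v)$ is the degree of $v$ in $\mathcal{R}_n$. *)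

theory Defs
  imports "HOL-Computational_Algebra.Polynomial"
begin

text \<open>Binary strings are lists of type \<^typ>\<open>bool list\<close>, with \<^const>\<open>True\<close> for 1 and \<^const>\<open>False\<close> for 0.\<close>

text \<open>The string \<open>w = u @ replicate k b @ v\<close> has the block of \<open>k\<close> letters \<open>b\<close> between \<open>u\<close> and \<open>v\<close>
  as a (nonempty, maximal) run.\<close>

definition is_run :: "bool list \<Rightarrow> bool \<Rightarrow> nat \<Rightarrow> bool list \<Rightarrow> bool" where
  "is_run u b k v \<longleftrightarrow> k \<ge> 1 \<and> (u = [] \<or> last u \<noteq> b) \<and> (v = [] \<or> hd v \<noteq> b)"

definition run_constrained :: "bool list \<Rightarrow> bool" where
  "run_constrained w \<longleftrightarrow>
     (\<forall>u k v. w = u @ replicate k True @ v \<and> is_run u True k v \<longrightarrow>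
        (\<exists>m v'. v = replicate m False @ v' \<and> is_run (u @ replicate k True) False m v' \<and> m > k))"

definition fib_run_verts :: "nat \<Rightarrow> bool list set" where
  "fib_run_verts n = {w. length w = n \<and> run_constrained (w @ [False, False])}"

definition fib_run_adj :: "nat \<Rightarrow> bool list \<Rightarrow> bool list \<Rightarrow> bool" where
  "fib_run_adj n v w \<longleftrightarrow> v \<in> fib_run_verts n \<and> w \<in> fib_run_verts n \<and>
     card {i. i < n \<and> v ! i \<noteq> w ! i} = 1"

definition fib_run_degree :: "nat \<Rightarrow> bool list \<Rightarrow> nat" where
  "fib_run_degree n v = card {w. fib_run_adj n v w}"

definition deg_enum :: "nat \<Rightarrow> int poly" where
  "deg_enum n = (\<Sum>v \<in> fib_run_verts n. monom 1 (fib_run_degree n v))"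

abbreviation X :: "int poly" where
  "X \<equiv> [:0, 1:]"

end

theory Submission
  imports Defs "HOL-Computational_Algebra.Formal_Power_Series"
begin

text \<open>A string is run-constrained iff it is a concatenation of atoms \<open>1\<^sup>k0\<^bsup>k+1\<^esup>\<close> with
  \<open>k \<ge> 0\<close>, and this factorisation is unique. The degree of a vertex is a sum of contributions of
  the atoms of \<open>w00\<close>: the atom \<open>0\<close> can be flipped iff the atom after its successor is again \<open>0\<close>;
  an atom with \<open>k \<ge> 1\<close> always allows flipping its first and last 1, and allows flipping its first 0
  iff it is followed by two atoms \<open>0\<close>. Classifying atom sequences by their first two atoms gives a
  linear system for generating functions over \<open>\<int>[x]\<close>; eliminating all unknowns but the total one
  yields the recurrence, up to a numerator of degree 8 in \<open>z\<close>, where \<open>g\<^sub>n\<close> is the coefficient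
  of \<open>z\<^bsup>n+2\<^esup>\<close>.\<close>

section \<open>An automaton for run-constrained strings\<close>

text \<open>In \<open>Zeros d\<close> at least \<open>d\<close> further zeros must be read before the next 1 or the end of
  the string; in \<open>Ones j\<close> the current run of 1s has length \<open>j + 1\<close>.\<close>

datatype state = Dead | Zeros nat | Ones nat

text \<open>A run of \<open>j + 1\<close> ones needs \<open>j + 2\<close> zeros. The zero read on
  leaving \<open>Ones j\<close> is one of them, so \<open>Suc j\<close> are still owed. Truncated
  subtraction makes surplus zeros harmless.\<close>

fun step :: "state \<Rightarrow> bool \<Rightarrow> state" where
  "step Dead b = Dead"
| "step (Zeros d) False = Zeros (d - 1)"
| "step (Zeros 0) True = Ones 0"
| "step (Zeros (Suc d)) True = Dead"
| "step (Ones j) True = Ones (Suc j)"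
| "step (Ones j) False = Zeros (Suc j)"

definition accepts :: "state \<Rightarrow> bool list \<Rightarrow> bool" where
  "accepts s w \<longleftrightarrow> foldl step s w = Zeros 0"

lemma accepts_Nil [simp]: "accepts s [] \<longleftrightarrow> s = Zeros 0"
  and accepts_Cons [simp]: "accepts s (b # w) \<longleftrightarrow> accepts (step s b) w"
  and accepts_append [simp]: "accepts s (u @ v) \<longleftrightarrow> accepts (foldl step s u) v"
  by (simp_all add: accepts_def)

lemma foldl_step_Dead [simp]: "foldl step Dead w = Dead"
  by (induction w) auto

lemma not_accepts_Dead [simp]: "\<not> accepts Dead w"
  by (simp add: accepts_def)

lemma foldl_step_Ones [simp]: "foldl step (Ones j) (replicate k True) = Ones (j + k)"
  by (induction k arbitrary: j) auto

lemma foldl_step_Zeros [simp]: "foldl step (Zeros d) (replicate k False) = Zeros (d - k)"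
  by (induction k arbitrary: d) auto

text \<open>Reading zeros in \<open>Zeros 0\<close> changes nothing, so a debt of \<open>d\<close>
  only forces \<open>d\<close> leading zeros and leaves the other requirements on the string as they
  were.\<close>

lemma accepts_Zeros_iff:
  "accepts (Zeros d) w \<longleftrightarrow> (\<exists>w'. w = replicate d False @ w') \<and> accepts (Zeros 0) w"
proof (induction w arbitrary: d)
  case Nil
  then show ?case by auto
next
  case (Cons b w)
  show ?case
  proof (cases d)
    case 0
    then show ?thesis by simp
  next
    case (Suc d')
    then show ?thesis
      using Cons.IH[of d'] by (cases b) auto
  qed
qed

text \<open>A final 1 leads to \<open>Ones\<close> or \<open>Dead\<close>, and a final 10 leads to a
  positive debt or \<open>Dead\<close>. This serves both to recover the suffix 00 and to exclude
  flips inside it.\<close>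

lemma accepts_last_two:
  assumes "accepts s (v @ [a, b])"
  shows "\<not> a" "\<not> b"
proof -
  have *: "step (step t a) b = Zeros 0 \<Longrightarrow> \<not> a \<and> \<not> b" for t
  proof (cases t)
    case (Zeros d)
    consider "d = 0" | "d = 1" | e where "d = Suc (Suc e)"
      by (cases d rule: nat.exhaust; cases "d - 1" rule: nat.exhaust) auto
    then show "step (step t a) b = Zeros 0 \<Longrightarrow> \<not> a \<and> \<not> b"
      unfolding Zeros by cases (cases a; cases b; simp)+
  qed (cases a; cases b; simp)+
  show "\<not> a" "\<not> b"
    using assms *[of "foldl step s v"] by simp_all
qed

section \<open>Run-constrained strings as sequences of atoms\<close>

lemma leading_ones_cases:
  obtains k where "w = replicate k True" | k w' where "w = replicate k True @ False # w'"
proof (induction w arbitrary: thesis)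
  case Nil
  show ?case using Nil(1)[of 0] by simp
next
  case (Cons b w)
  show ?case
  proof (cases b)
    case True
    show ?thesis
    proof (rule Cons.IH)
      show ?thesis if "w = replicate k True" for k
        using Cons.prems(1)[of "Suc k"] that True by simp
      show ?thesis if "w = replicate k True @ False # w'" for k w'
        using Cons.prems(2)[of "Suc k" w'] that True by simp
    qed
  next
    case False
    then show ?thesis
      using Cons.prems(2)[of 0 w] by simp
  qed
qed

lemma run_constrained_Nil: "run_constrained []"
  by (auto simp: run_constrained_def is_run_def)

lemma run_constrained_Cons_False: "run_constrained (False # w) \<longleftrightarrow> run_constrained w"
proof
  assume L: "run_constrained (False # w)"
  show "run_constrained w"
    unfolding run_constrained_def
  proof (intro allI impI)
    fix u k v
    assume a: "w = u @ replicate k True @ v \<and> is_run u True k v"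
    then have "False # w = (False # u) @ replicate k True @ v \<and> is_run (False # u) True k v"
      by (auto simp: is_run_def)
    with L obtain m v' where "v = replicate m False @ v'"
        "is_run ((False # u) @ replicate k True) False m v'" "m > k"
      unfolding run_constrained_def by blast
    moreover from this have "is_run (u @ replicate k True) False m v'"
      using a by (auto simp: is_run_def)
    ultimately show
      "\<exists>m v'. v = replicate m False @ v' \<and> is_run (u @ replicate k True) False m v' \<and> m > k"
      by blast
  qed
next
  assume R: "run_constrained w"
  show "run_constrained (False # w)"
    unfolding run_constrained_def
  proof (intro allI impI)
    fix u k v
    assume a: "False # w = u @ replicate k True @ v \<and> is_run u True k v"
    then obtain u' where u: "u = False # u'"
      by (cases u; cases k) (auto simp: is_run_def)
    with a have "w = u' @ replicate k True @ v \<and> is_run u' True k v"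
      by (auto simp: is_run_def)
    with R obtain m v' where "v = replicate m False @ v'"
        "is_run (u' @ replicate k True) False m v'" "m > k"
      unfolding run_constrained_def by blast
    moreover from this have "is_run (u @ replicate k True) False m v'"
      using a by (auto simp: is_run_def)
    ultimately show
      "\<exists>m v'. v = replicate m False @ v' \<and> is_run (u @ replicate k True) False m v' \<and> m > k"
      by blast
  qed
qed

lemma not_run_constrained_ones: "k \<ge> 1 \<Longrightarrow> \<not> run_constrained (replicate k True)"
proof
  assume k: "k \<ge> 1" and "run_constrained (replicate k True)"
  moreover have "replicate k True = [] @ replicate k True @ [] \<and> is_run [] True k []"
    using k by (simp add: is_run_def)
  ultimately obtain m v' where "[] = replicate m False @ v'" "m > k"
    unfolding run_constrained_def by blast
  then show False by simp
qed

text \<open>A nonempty \<open>u\<close> ends in 0, so it must reach past the leading ones; hence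
  every run of ones other than the leading one lies inside \<open>w\<close>.\<close>

lemma run_after_leading_ones:
  assumes "u @ replicate j True @ v = replicate k True @ False # w" "is_run u True j v" "k \<ge> 1"
  shows "(u = [] \<and> j = k \<and> v = False # w) \<or>
    (\<exists>u'. u = replicate k True @ False # u' \<and> w = u' @ replicate j True @ v)"
proof (cases "u = []")
  case True
  have "j = k \<and> v = False # w"
    using assms(1,2) True
  proof (induction j arbitrary: k)
    case 0
    then show ?case by (simp add: is_run_def)
  next
    case (Suc j)
    show ?case
    proof (cases k)
      case 0
      then show ?thesis using Suc by simp
    next
      case k: (Suc k')
      show ?thesis
      proof (cases "j = 0")
        case True
        then show ?thesis
          using Suc.prems k by (cases k'; cases v) (auto simp: is_run_def)
      next
        case False
        then show ?thesis
          using Suc.IH[of k'] Suc.prems k by (auto simp: is_run_def)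
      qed
    qed
  qed
  with True show ?thesis by simp
next
  case False
  then have last: "\<not> last u" using assms(2) by (auto simp: is_run_def)
  have "\<not> length u \<le> k"
  proof
    assume le: "length u \<le> k"
    have "u = take (length u) (replicate k True @ False # w)"
      by (metis assms(1) append_eq_conv_conj)
    also have "\<dots> = replicate (length u) True" using le by (simp add: min_def)
    finally show False using False last by (metis last_replicate length_0_conv)
  qed
  then have "take (Suc k) u = take (Suc k) (u @ replicate j True @ v)" by simp
  also have "\<dots> = replicate k True @ [False]" by (simp add: assms(1))
  finally have "u = (replicate k True @ [False]) @ drop (Suc k) u"
    by (metis append_take_drop_id)
  then show ?thesis using assms(1)
    by (metis append.assoc append_Cons append_Nil same_append_eq)
qed

lemma leading_zeros_cases:
  obtains i w' where "w = replicate i False @ w'" "w' = [] \<or> hd w'"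
proof (induction w arbitrary: thesis)
  case Nil
  show ?case using Nil[of 0 "[]"] by simp
next
  case (Cons b w)
  show ?case
  proof (cases b)
    case True
    show ?thesis
      using Cons.prems[of 0 "b # w"] True by simp
  next
    case False
    show ?thesis
    proof (rule Cons.IH)
      show ?thesis if "w = replicate i False @ w'" "w' = [] \<or> hd w'" for i w'
        using Cons.prems[of "Suc i" w'] that False by simp
    qed
  qed
qed

text \<open>The displayed \<open>False\<close> is the one zero by which the zeros must outnumber the
  ones, so only \<open>k\<close> more are demanded of \<open>w\<close>; all later runs lie inside
  \<open>w\<close>.\<close>

lemma run_constrained_leading_ones:
  assumes k: "k \<ge> 1"
  shows "run_constrained (replicate k True @ False # w) \<longleftrightarrow>
    (\<exists>w'. w = replicate k False @ w') \<and> run_constrained w"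
proof (intro iffI conjI)
  assume L: "run_constrained (replicate k True @ False # w)"
  have "replicate k True @ False # w = [] @ replicate k True @ (False # w) \<and>
      is_run [] True k (False # w)"
    using k by (simp add: is_run_def)
  with L obtain m v' where m: "False # w = replicate m False @ v'" "m > k"
    unfolding run_constrained_def by blast
  then obtain i where "m = Suc (k + i)" by (metis less_iff_Suc_add)
  with m show "\<exists>w'. w = replicate k False @ w'" by (auto simp: replicate_add)
  show "run_constrained w"
    unfolding run_constrained_def
  proof (intro allI impI)
    fix u j v
    assume a: "w = u @ replicate j True @ v \<and> is_run u True j v"
    let ?u = "replicate k True @ False # u"
    have "replicate k True @ False # w = ?u @ replicate j True @ v \<and> is_run ?u True j v"
      using a by (auto simp: is_run_def)
    with L obtain m v' where "v = replicate m False @ v'"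
        "is_run (?u @ replicate j True) False m v'" "m > j"
      unfolding run_constrained_def by blast
    moreover from this have "is_run (u @ replicate j True) False m v'"
      using a by (auto simp: is_run_def)
    ultimately show
      "\<exists>m v'. v = replicate m False @ v' \<and> is_run (u @ replicate j True) False m v' \<and> m > j"
      by blast
  qed
next
  assume R: "(\<exists>w'. w = replicate k False @ w') \<and> run_constrained w"
  show "run_constrained (replicate k True @ False # w)"
    unfolding run_constrained_def
  proof (intro allI impI)
    fix u j v
    assume a: "replicate k True @ False # w = u @ replicate j True @ v \<and> is_run u True j v"
    then consider "u = []" "j = k" "v = False # w"
      | u' where "u = replicate k True @ False # u'" "w = u' @ replicate j True @ v"
      using run_after_leading_ones k by metis
    then show "\<exists>m v'. v = replicate m False @ v' \<and> is_run (u @ replicate j True) False m v' \<and> m > j"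
    proof cases
      case 1
      from R obtain w' where "w = replicate k False @ w'" by blast
      \<comment> \<open>\<open>is_run\<close> demands a maximal block of zeros, so the zeros in
        front of \<open>w'\<close> have to be joined to it.\<close>
      moreover obtain i w'' where "w' = replicate i False @ w''" "w'' = [] \<or> hd w''"
        by (rule leading_zeros_cases)
      ultimately have "v = replicate (Suc (k + i)) False @ w'' \<and>
          is_run (u @ replicate j True) False (Suc (k + i)) w'' \<and> Suc (k + i) > j"
        using 1 k by (auto simp: replicate_add is_run_def)
      then show ?thesis by blast
    next
      case 2
      then have "is_run u' True j v" using a by (auto simp: is_run_def split: if_splits)
      with R 2 obtain m v' where "v = replicate m False @ v'"
          "is_run (u' @ replicate j True) False m v'" "m > j"
        unfolding run_constrained_def by blast
      moreover from this have "is_run (u @ replicate j True) False m v'"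
        using a by (auto simp: is_run_def)
      ultimately show ?thesis by blast
    qed
  qed
qed

text \<open>Both sides obey the same recursion when a leading 0, or a leading run of ones with its
  first zero, is stripped; both fail on a nonempty string of ones only.\<close>

lemma run_constrained_iff_accepts: "run_constrained w \<longleftrightarrow> accepts (Zeros 0) w"
proof (induction w rule: length_induct)
  case (1 w)
  consider "w = []" | k where "k \<ge> 1" "w = replicate k True" | w' where "w = False # w'"
    | k w' where "w = replicate (Suc k) True @ False # w'"
  proof (cases w rule: leading_ones_cases)
    case (1 k)
    then show ?thesis using that(1) that(2)[of k] by (cases k) auto
  next
    case (2 k w')
    then show ?thesis using that(3,4) by (cases k) auto
  qed
  then show ?case
  proof cases
    case 1
    then show ?thesis by (simp add: run_constrained_Nil)
  next
    case 2
    then show ?thesis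
      using not_run_constrained_ones[of k] by (cases k) (auto simp: accepts_def)
  next
    case 3
    then show ?thesis using 1 by (simp add: run_constrained_Cons_False)
  next
    case 4
    then have "run_constrained w' \<longleftrightarrow> accepts (Zeros 0) w'" using 1 by simp
    then show ?thesis
      using 4 run_constrained_leading_ones[of "Suc k" w'] accepts_Zeros_iff[of "Suc k" w'] by simp
  qed
qed

section \<open>Unique factorisation into atoms\<close>

definition atom :: "nat \<Rightarrow> bool list" where
  "atom k = replicate k True @ replicate (Suc k) False"

fun word :: "nat list \<Rightarrow> bool list" where
  "word [] = []"
| "word (k # t) = atom k @ word t"

fun asize :: "nat list \<Rightarrow> nat" where
  "asize [] = 0"
| "asize (k # t) = 2 * k + 1 + asize t"

lemma length_word [simp]: "length (word t) = asize t"
  by (induction t) (auto simp: atom_def)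

lemma foldl_step_atom [simp]: "foldl step (Zeros 0) (atom k) = Zeros 0"
  by (cases k) (auto simp: atom_def)

lemma accepts_word [simp]: "accepts (Zeros 0) (word t)"
  by (induction t) auto

text \<open>After \<open>k\<close> ones and one zero the debt is exactly \<open>k\<close>, so the
  next \<open>k\<close> zeros complete an atom and the remaining suffix is again accepted from
  \<open>Zeros 0\<close>.\<close>

lemma accepts_imp_word: "accepts (Zeros 0) w \<Longrightarrow> \<exists>t. w = word t"
proof (induction w rule: length_induct)
  case (1 w)
  show ?case
  proof (cases w rule: leading_ones_cases)
    case (1 k)
    then show ?thesis
      using \<open>accepts (Zeros 0) w\<close> by (cases k) (auto simp: accepts_def intro: exI[of _ "[]"])
  next
    case (2 k w')
    then have "accepts (Zeros k) w'"
      using \<open>accepts (Zeros 0) w\<close> by (cases k) auto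
    then obtain v where v: "w' = replicate k False @ v" "accepts (Zeros 0) v"
      using accepts_Zeros_iff[of k w'] by auto
    then obtain t where "v = word t"
      using "1.IH"[rule_format, of v] 2 by auto
    then have "w = word (k # t)" using 2 v by (simp add: atom_def)
    then show ?thesis by blast
  qed
qed

text \<open>The first atom can be read off as the number of leading ones.\<close>

lemma inj_word: "inj word"
proof (rule injI)
  show "word t = word t' \<Longrightarrow> t = t'" for t t'
  proof (induction t arbitrary: t')
    case Nil
    then show ?case by (cases t') (auto simp: atom_def)
  next
    case (Cons k t)
    then obtain k' s where t': "t' = k' # s"
      by (cases t') (auto simp: atom_def)
    have *: "length (takeWhile id (word (i # r))) = i" for i r
      by (simp add: atom_def takeWhile_append)
    from Cons.prems t' have "k = k'" using * by metis
    with Cons t' show ?case by simp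
  qed
qed

section \<open>The degree in terms of atoms\<close>

text \<open>Carrying the automaton state along makes this count computable atom by atom.\<close>

fun flips :: "state \<Rightarrow> bool list \<Rightarrow> nat" where
  "flips s [] = 0"
| "flips s (b # w) = of_bool (accepts (step s (\<not> b)) w) + flips (step s b) w"

lemma flips_eq_card: "flips s w = card {i. i < length w \<and> accepts s (w[i := \<not> w ! i])}"
proof (induction w arbitrary: s)
  case Nil
  then show ?case by simp
next
  case (Cons b w)
  let ?A = "{i. i < length w \<and> accepts (step s b) (w[i := \<not> w ! i])}"
  have "{i. i < length (b # w) \<and> accepts s ((b # w)[i := \<not> (b # w) ! i])} =
      (if accepts (step s (\<not> b)) w then {0} else {}) \<union> Suc ` ?A" (is "?L = ?R")
  proof (rule set_eqI)
    show "i \<in> ?L \<longleftrightarrow> i \<in> ?R" for i by (cases i) auto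
  qed
  moreover have "card (Suc ` ?A) = card ?A" by (simp add: card_image)
  moreover have "finite ?A" by simp
  ultimately show ?case by (simp add: Cons)
qed

text \<open>Flipping an atom 0 gives the next atom \<open>k\<close> an extra 1, which costs one more
  zero. Flipping the first zero of a positive atom adds a 1 and removes a 0, which costs two more.
  In atom 1 the first and the last 1 coincide, hence the value 1 in place of 2.\<close>

fun adeg :: "nat list \<Rightarrow> nat" where
  "adeg [] = 0"
| "adeg (0 # t) = of_bool (\<exists>k r. t = k # 0 # r) + adeg t"
| "adeg (Suc k # t) = (if k = 0 then 1 else 2) + of_bool (\<exists>r. t = 0 # 0 # r) + adeg t"

text \<open>A positive atom starts with 1, so a debt can only be paid by atoms 0, one zero
  each.\<close>

lemma accepts_Zeros_Suc_word:
  "accepts (Zeros (Suc d)) (word t) \<longleftrightarrow> (\<exists>r. t = 0 # r \<and> accepts (Zeros d) (word r))"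
proof (cases t)
  case (Cons k r)
  then show ?thesis by (cases k) (auto simp: atom_def)
qed auto

text \<open>\<open>Ones 0\<close> is the state after an atom 0 has been turned into 1; the next atom
  then leaves a debt of one zero.\<close>

lemma accepts_Ones_word: "accepts (Ones 0) (word t) \<longleftrightarrow> (\<exists>k r. t = k # 0 # r)"
proof (cases t)
  case (Cons k r)
  have "accepts (Ones 0) (word t) \<longleftrightarrow> accepts (Zeros (Suc 0)) (word r)"
    by (simp add: Cons atom_def)
  then show ?thesis by (auto simp: Cons accepts_Zeros_Suc_word)
qed auto

lemma flips_Zeros: "flips (Zeros d) (replicate d False @ v) = flips (Zeros 0) v"
  by (induction d) auto

text \<open>This evaluates the part of an atom behind its first \<open>j + 1\<close> ones. Flipping
  a 1 before the last creates a debt that the next 1 violates. Flipping the first zero leaves a debt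
  of 2 in front of \<open>v\<close>; the zeros after it are all owed and cannot be flipped.\<close>

lemma flips_Ones:
  assumes "accepts (Zeros 0) v"
  shows "flips (Ones j) (replicate i True @ replicate (Suc (Suc (i + j))) False @ v) =
    of_bool (i > 0) + of_bool (accepts (Zeros 2) v) + flips (Zeros 0) v"
proof (induction i arbitrary: j)
  case 0
  have "Suc (Suc j) - j = 2" by simp
  then show ?case using flips_Zeros[of "Suc j" v] by simp
next
  case (Suc i)
  have "accepts (Zeros (Suc j)) (replicate i True @ replicate (Suc (Suc (Suc i + j))) False @ v)
      \<longleftrightarrow> i = 0"
    using assms by (cases i) auto
  then show ?case using Suc[of "Suc j"] by simp
qed

lemma flips_word: "flips (Zeros 0) (word t) = adeg t"
proof (induction t rule: adeg.induct)
  case (3 k t)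
  \<comment> \<open>This is the flip of the first 1 of atom \<open>Suc k\<close>; the remaining
    flips are covered by \<open>flips_Ones\<close> with \<open>j = 0\<close>.\<close>
  have "accepts (Zeros 0) (replicate k True @ replicate (Suc (Suc k)) False @ word t)"
    by (cases k) auto
  then show ?case
    using 3 flips_Ones[of "word t" 0 k]
    by (auto simp: atom_def numeral_2_eq_2 accepts_Zeros_Suc_word)
qed (auto simp: atom_def accepts_Ones_word)

section \<open>From the graph to atom sequences\<close>

lemma card_diff_eq_1_iff:
  assumes "length v = n" "length w = n"
  shows "card {i. i < n \<and> v ! i \<noteq> w ! i} = 1 \<longleftrightarrow> (\<exists>i<n. w = v[i := \<not> v ! i])"
proof
  assume "card {i. i < n \<and> v ! i \<noteq> w ! i} = 1"
  then obtain i where i: "{i. i < n \<and> v ! i \<noteq> w ! i} = {i}" by (auto simp: card_1_singleton_iff)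
  then have diff: "j < n \<Longrightarrow> v ! j \<noteq> w ! j \<longleftrightarrow> j = i" for j by blast
  have "w = v[i := \<not> v ! i]"
  proof (rule nth_equalityI)
    fix j assume "j < length w"
    then show "w ! j = v[i := \<not> v ! i] ! j"
      using diff[of j] assms by (cases "j = i") auto
  qed (simp add: assms)
  with i show "\<exists>i<n. w = v[i := \<not> v ! i]" by blast
next
  assume "\<exists>i<n. w = v[i := \<not> v ! i]"
  then obtain i where i: "i < n" "w = v[i := \<not> v ! i]" by blast
  have "j < n \<and> v ! j \<noteq> w ! j \<longleftrightarrow> j = i" for j
    using i assms(1) by (cases "j = i") simp_all
  then have "{i. i < n \<and> v ! i \<noteq> w ! i} = {i}" by blast
  then show "card {i. i < n \<and> v ! i \<noteq> w ! i} = 1" by simp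
qed

text \<open>Neighbours correspond injectively to admissible flip positions. \<open>flips\<close>
  also ranges over the two appended zeros, but flipping either of them is excluded by
  \<open>accepts_last_two\<close>.\<close>

lemma fib_run_degree_eq_flips:
  assumes "v \<in> fib_run_verts n"
  shows "fib_run_degree n v = flips (Zeros 0) (v @ [False, False])"
proof -
  let ?W = "v @ [False, False]"
  let ?f = "\<lambda>i. v[i := \<not> v ! i]"
  let ?I = "{i. i < n \<and> accepts (Zeros 0) (?f i @ [False, False])}"
  have len: "length v = n" using assms by (simp add: fib_run_verts_def)
  have "fib_run_adj n v w \<longleftrightarrow> w \<in> ?f ` ?I" for w
  proof -
    have "fib_run_adj n v w \<longleftrightarrow>
        length w = n \<and> accepts (Zeros 0) (w @ [False, False]) \<and> (\<exists>i<n. w = ?f i)"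
      using assms card_diff_eq_1_iff[OF len, of w]
      unfolding fib_run_adj_def fib_run_verts_def run_constrained_iff_accepts by blast
    also have "\<dots> \<longleftrightarrow> w \<in> ?f ` ?I"
      using len by (auto simp del: accepts_append)
    finally show ?thesis .
  qed
  then have "{w. fib_run_adj n v w} = ?f ` ?I" by blast
  moreover have "inj_on ?f ?I"
  proof (rule inj_onI)
    fix i j assume i: "i \<in> ?I" and eq: "?f i = ?f j"
    from i have "?f i ! i \<noteq> v ! i" using len by simp
    then show "i = j" unfolding eq by (cases "i = j") auto
  qed
  moreover have "{i. i < length ?W \<and> accepts (Zeros 0) (?W[i := \<not> ?W ! i])} = ?I"
  proof (rule set_eqI)
    fix i
    consider "i < n" | "i = n" | "i = Suc n" | "i > Suc n" by linarith
    then show "i \<in> {i. i < length ?W \<and> accepts (Zeros 0) (?W[i := \<not> ?W ! i])} \<longleftrightarrow> i \<in> ?I"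
    proof cases
      case 1
      then show ?thesis using len by (simp add: list_update_append nth_append)
    next
      case 2
      then have "?W[i := \<not> ?W ! i] = v @ [True, False]"
        using len by (simp add: list_update_append nth_append)
      moreover have "\<not> accepts (Zeros 0) (v @ [True, False])"
        using accepts_last_two(1) by blast
      ultimately show ?thesis using 2 by (simp only: mem_Collect_eq) simp
    next
      case 3
      then have "?W[i := \<not> ?W ! i] = v @ [False, True]"
        using len by (simp add: list_update_append nth_append)
      moreover have "\<not> accepts (Zeros 0) (v @ [False, True])"
        using accepts_last_two(2) by blast
      ultimately show ?thesis using 3 by (simp only: mem_Collect_eq) simp
    next
      case 4
      then show ?thesis using len by simp
    qed
  qed
  ultimately show ?thesis
    unfolding fib_run_degree_def flips_eq_card by (simp only: card_image)
qed

text \<open>Surjectivity rests on the fact that every accepted string of length \<open>n + 2\<close>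
  ends in 00.\<close>

lemma bij_betw_fib_run_verts:
  "bij_betw (\<lambda>v. v @ [False, False]) (fib_run_verts n) (word ` {t. asize t = n + 2})"
proof (rule bij_betwI')
  fix v assume "v \<in> fib_run_verts n"
  then have "accepts (Zeros 0) (v @ [False, False])" "length v = n"
    by (simp_all only: fib_run_verts_def run_constrained_iff_accepts mem_Collect_eq)
  then obtain t where t: "v @ [False, False] = word t"
    using accepts_imp_word by blast
  have "asize t = length (v @ [False, False])"
    unfolding t by simp
  also have "\<dots> = n + 2" using \<open>length v = n\<close> by simp
  finally show "v @ [False, False] \<in> word ` {t. asize t = n + 2}"
    unfolding t by blast
next
  fix W assume "W \<in> word ` {t. asize t = n + 2}"
  then have W: "accepts (Zeros 0) W" "length W = n + 2" by auto
  obtain v u where v: "W = v @ u" "length v = n"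
    using that[of "take n W" "drop n W"] W(2) by simp
  with W(2) have "length u = Suc (Suc 0)" by simp
  then obtain a b where u: "u = [a, b]" unfolding length_Suc_conv by blast
  have "\<not> a" "\<not> b" using accepts_last_two W(1) unfolding v(1) u by blast+
  with u have u': "u = [False, False]" by simp
  have "v \<in> fib_run_verts n"
    using W(1) v(2) unfolding fib_run_verts_def run_constrained_iff_accepts v(1) u' by blast
  then show "\<exists>v\<in>fib_run_verts n. W = v @ [False, False]" using v(1) u' by blast
qed simp

lemma deg_enum_eq: "deg_enum n = (\<Sum>t | asize t = n + 2. monom 1 (adeg t))"
proof -
  have "deg_enum n = (\<Sum>v\<in>fib_run_verts n. monom 1 (flips (Zeros 0) (v @ [False, False])))"
    unfolding deg_enum_def by (rule sum.cong) (simp_all only: fib_run_degree_eq_flips)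
  also have "\<dots> = (\<Sum>W\<in>word ` {t. asize t = n + 2}. monom 1 (flips (Zeros 0) W))"
    by (rule sum.reindex_bij_betw[OF bij_betw_fib_run_verts])
  also have "\<dots> = (\<Sum>t | asize t = n + 2. monom 1 (adeg t))"
    by (subst sum.reindex) (auto simp: flips_word intro: inj_on_subset[OF inj_word])
  finally show ?thesis .
qed

section \<open>Generating functions\<close>

unbundle fps_syntax

lemma finite_asize: "finite {t. asize t = N}"
proof -
  have "set t \<subseteq> {..asize t} \<and> length t \<le> asize t" for t
    by (induction t) auto
  then have "{t. asize t = N} \<subseteq> {t. set t \<subseteq> {..N} \<and> length t \<le> N}" by blast
  then show ?thesis by (rule finite_subset) (rule finite_lists_length_le, simp)
qed

text \<open>The series variable \<open>fps_X\<close> marks length and the polynomial variable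
  \<open>X\<close> marks degree.\<close>

definition gf :: "nat list set \<Rightarrow> int poly fps" where
  "gf A = Abs_fps (\<lambda>N. \<Sum>t | t \<in> A \<and> asize t = N. monom 1 (adeg t))"

lemma gf_Un: "A \<inter> B = {} \<Longrightarrow> gf (A \<union> B) = gf A + gf B"
proof (rule fps_ext)
  fix N assume "A \<inter> B = {}"
  moreover have "{t. t \<in> A \<union> B \<and> asize t = N} =
      {t. t \<in> A \<and> asize t = N} \<union> {t. t \<in> B \<and> asize t = N}" by blast
  moreover have "finite {t. t \<in> C \<and> asize t = N}" for C
    by (rule finite_subset[OF _ finite_asize[of N]]) blast
  ultimately show "gf (A \<union> B) $ N = (gf A + gf B) $ N"
    by (simp add: gf_def) (subst sum.union_disjoint; auto)
qed

lemma gf_image: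
  assumes "inj_on f A" "\<And>t. t \<in> A \<Longrightarrow> asize (f t) = asize t + m"
    "\<And>t. t \<in> A \<Longrightarrow> adeg (f t) = adeg t + d"
  shows "gf (f ` A) = fps_const (X ^ d) * fps_X ^ m * gf A"
proof (rule fps_ext)
  fix N
  show "gf (f ` A) $ N = (fps_const (X ^ d) * fps_X ^ m * gf A) $ N"
  proof (cases "N < m")
    case True
    then have "{t. t \<in> f ` A \<and> asize t = N} = {}" using assms(2) by auto
    then have "gf (f ` A) $ N = 0" unfolding gf_def fps_nth_Abs_fps by (simp only: sum.empty)
    then show ?thesis using True by (simp add: mult.assoc fps_X_power_mult_nth)
  next
    case False
    have X: "X ^ d = monom 1 d" by (simp add: monom_altdef)
    have "{t. t \<in> f ` A \<and> asize t = N} = f ` {t. t \<in> A \<and> asize t = N - m}"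
      using assms(2) False by auto
    moreover have "inj_on f {t. t \<in> A \<and> asize t = N - m}"
      by (rule inj_on_subset[OF assms(1)]) blast
    ultimately have "gf (f ` A) $ N = (\<Sum>t | t \<in> A \<and> asize t = N - m. monom 1 (adeg (f t)))"
      by (simp add: gf_def sum.reindex)
    also have "\<dots> = (\<Sum>t | t \<in> A \<and> asize t = N - m. X ^ d * monom 1 (adeg t))"
      unfolding X by (rule sum.cong) (auto simp: assms(3) mult_monom add.commute)
    finally show ?thesis using False
      by (simp add: gf_def mult.assoc fps_X_power_mult_nth sum_distrib_left)
  qed
qed

text \<open>\<open>S\<close> collects the tails that allow the leading atom one extra flip. They
  carry an extra factor \<open>X\<close>; writing it as \<open>1 + (X - 1)\<close> leaves only
  \<open>A\<close> and \<open>A \<inter> S\<close>.\<close>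

lemma gf_Cons:
  assumes "\<And>t. adeg (k # t) = adeg t + (d + of_bool (t \<in> S))"
  shows "gf (Cons k ` A) =
    fps_const (X ^ d) * fps_X ^ (2 * k + 1) * (gf A + (fps_const X - 1) * gf (A \<inter> S))"
proof -
  have "gf (Cons k ` A) = gf (Cons k ` (A \<inter> S) \<union> Cons k ` (A - S))"
    by (rule arg_cong[of _ _ gf]) blast
  also have "\<dots> = gf (Cons k ` (A \<inter> S)) + gf (Cons k ` (A - S))"
    by (rule gf_Un) blast
  also have "gf (Cons k ` (A \<inter> S)) =
      fps_const (X ^ (d + 1)) * fps_X ^ (2 * k + 1) * gf (A \<inter> S)"
    by (rule gf_image) (auto simp: assms)
  also have "gf (Cons k ` (A - S)) = fps_const (X ^ d) * fps_X ^ (2 * k + 1) * gf (A - S)"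
    by (rule gf_image) (auto simp: assms)
  also have "gf (A - S) = gf A - gf (A \<inter> S)"
    using gf_Un[of "A \<inter> S" "A - S"] by (simp add: Int_Diff_Un Int_Diff_disjoint)
  also have "fps_const (X ^ (d + 1)) = fps_const X * fps_const (X ^ d)" by simp
  finally show ?thesis by (simp only: algebra_simps mult_1)
qed

text \<open>Shortening the leading atom by one removes two letters and keeps the degree as long as
  the atom still has at least two 1s; hence the factor \<open>1 - fps_X\<^sup>2\<close>.\<close>

lemma gf_leading_nonzero:
  assumes "B = (\<lambda>(k, t). Suc k # t) ` (UNIV \<times> A)"
  shows "(1 - fps_X\<^sup>2) * gf B =
    (fps_const X * fps_X ^ 3 + fps_const X * (fps_const X - 1) * fps_X ^ 5) *
    (gf A + (fps_const X - 1) * gf (A \<inter> {t. \<exists>r. t = 0 # 0 # r}))" (is "_ = _ * ?Y")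
proof -
  \<comment> \<open>Atom 1 is kept apart because lengthening it to atom 2 separates its first 1 from
    its last and so raises the degree.\<close>
  let ?R = "(\<lambda>(k, t). Suc (Suc k) # t) ` (UNIV \<times> A)"
  let ?bump = "\<lambda>t. Suc (hd t) # tl t"
  have "B = Cons 1 ` A \<union> ?R" (is "_ = ?C")
  proof
    show "B \<subseteq> ?C"
    proof
      fix s assume "s \<in> B"
      then obtain k t where "s = Suc k # t" "t \<in> A" using assms by auto
      then show "s \<in> ?C" by (cases k) auto
    qed
  qed (use assms in force)
  moreover have "Cons 1 ` A \<inter> ?R = {}" by auto
  ultimately have B: "gf B = gf (Cons 1 ` A) + gf ?R" using gf_Un by metis
  have one: "gf (Cons 1 ` A) = fps_const (X ^ 1) * fps_X ^ (2 * 1 + 1) * ?Y"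
    by (rule gf_Cons) auto
  have "?R = Cons 2 ` A \<union> ?bump ` ?R" (is "_ = ?C")
  proof
    show "?R \<subseteq> ?C"
    proof
      fix s assume "s \<in> ?R"
      then obtain k t where "s = Suc (Suc k) # t" "t \<in> A" by auto
      then show "s \<in> ?C" by (cases k) (force simp: image_iff numeral_2_eq_2)+
    qed
  qed (force simp: numeral_2_eq_2)
  moreover have "Cons 2 ` A \<inter> ?bump ` ?R = {}" by auto
  ultimately have R: "gf ?R = gf (Cons 2 ` A) + gf (?bump ` ?R)" using gf_Un by metis
  have two: "gf (Cons 2 ` A) = fps_const (X ^ 2) * fps_X ^ (2 * 2 + 1) * ?Y"
    by (rule gf_Cons) (auto simp: numeral_2_eq_2)
  have bump: "gf (?bump ` ?R) = fps_const (X ^ 0) * fps_X ^ 2 * gf ?R"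
    by (rule gf_image) (auto simp: inj_on_def)
  have "fps_const (X\<^sup>2) = (fps_const X)\<^sup>2" by (simp add: power2_eq_square)
  then have "gf ?R = (fps_const X)\<^sup>2 * fps_X ^ 5 * ?Y + fps_X ^ 2 * gf ?R"
    using R two bump by simp
  moreover have "gf B = fps_const X * fps_X ^ 3 * ?Y + gf ?R"
    using B one by simp
  \<comment> \<open>Atom 1 contributes \<open>x z^3 (1 - z^2)\<close> and the longer atoms
    \<open>x^2 z^5\<close>; together they give the term \<open>x (x - 1) z^5\<close>.\<close>
  ultimately show ?thesis by algebra
qed

text \<open>The unknowns are classes by the first two atoms: \<open>Z\<close> first atom 0,
  \<open>V\<close> both 0, \<open>U\<close> second 0, \<open>B\<close> first positive,
  \<open>C\<close> first positive and second 0. The combination \<open>W\<close> occurs in the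
  equations for both \<open>V\<close> and \<open>C\<close>. The last summand is the
  numerator.\<close>

lemma gf_all_equation:
  fixes F x z :: "int poly fps"
  defines "F \<equiv> gf UNIV" and "x \<equiv> fps_const X" and "z \<equiv> fps_X"
  shows "F = x * z * F + 2 * z ^ 2 * F - x * z ^ 3 * F - z ^ 4 * F + x * (x - 1) * z ^ 5 * F
    - x * (x ^ 2 - 1) * z ^ 7 * F - 2 * x ^ 2 * (x - 1) ^ 2 * z ^ 9 * F
    - x ^ 2 * (x - 1) ^ 3 * z ^ 11 * F
    + (1 - z ^ 2) * ((1 - z ^ 2) * (1 - (x - 1) * z - (x - 1) * z ^ 2)
      - (x - 1) * z * (x * z ^ 3 + x * (x - 1) * z ^ 5))"
proof -
  let ?zero = "range (Cons 0) :: nat list set" and ?zz = "{t :: nat list. \<exists>r. t = 0 # 0 # r}"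
    and ?sz = "{t :: nat list. \<exists>k r. t = k # 0 # r}"
  let ?big = "\<lambda>A. (\<lambda>(k, t). Suc k # t) ` (UNIV \<times> A) :: nat list set"
  define Z V U B C W where "Z = gf ?zero" and "V = gf ?zz" and "U = gf ?sz"
    and "B = gf (?big UNIV)" and "C = gf (?big ?zero)" and "W = Z + (x - 1) * V"
  have cons0: "gf (Cons 0 ` A) = z * (gf A + (x - 1) * gf (A \<inter> ?sz))" for A
    using gf_Cons[of 0 0 ?sz A] by (simp add: x_def z_def)
  have "(UNIV :: nat list set) = {[]} \<union> (?zero \<union> ?big UNIV)"
  proof -
    have "t \<in> {[]} \<union> (?zero \<union> ?big UNIV)" for t
    proof (cases t)
      case (Cons k r)
      then show ?thesis by (cases k) auto
    qed auto
    then show ?thesis by blast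
  qed
  then have "F = gf ({[]} \<union> (?zero \<union> ?big UNIV))" by (simp add: F_def)
  also have "\<dots> = gf {[]} + gf (?zero \<union> ?big UNIV)" by (rule gf_Un) auto
  also have "gf (?zero \<union> ?big UNIV) = Z + B" unfolding Z_def B_def by (rule gf_Un) auto
  also have "gf {[]} = 1"
  proof (rule fps_ext)
    fix N
    have "{t. t \<in> {[]} \<and> asize t = N} = (if N = 0 then {[]} else {})" by auto
    then show "gf {[]} $ N = 1 $ N" by (simp add: gf_def)
  qed
  finally have F: "F = 1 + (Z + B)" .
  have Z: "Z = z * (F + (x - 1) * U)"
    using cons0[of UNIV] by (simp add: Z_def F_def U_def)
  have "?zero \<inter> ?sz = ?zz" "Cons 0 ` ?zero = ?zz" by auto
  then have V: "V = z * W"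
    using cons0[of ?zero] unfolding Z_def V_def W_def by (simp only:)
  have "?sz = ?zz \<union> ?big ?zero"
  proof (rule set_eqI)
    show "t \<in> ?sz \<longleftrightarrow> t \<in> ?zz \<union> ?big ?zero" for t
    proof (cases t)
      case (Cons k r)
      then show ?thesis by (cases k) auto
    qed auto
  qed
  then have "U = gf (?zz \<union> ?big ?zero)" by (simp add: U_def)
  also have "\<dots> = V + C" unfolding V_def C_def by (rule gf_Un) auto
  finally have U: "U = V + C" .
  define D q where "D = x * z ^ 3 + x * (x - 1) * z ^ 5" and "q = 1 - z ^ 2"
  have B: "q * B = D * (F + (x - 1) * V)"
    using gf_leading_nonzero[OF refl, of UNIV]
    by (simp add: B_def F_def V_def D_def q_def x_def z_def)
  have "?zero \<inter> ?zz = ?zz" by auto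
  then have C: "q * C = D * W"
    using gf_leading_nonzero[OF refl, of ?zero]
    by (simp add: C_def W_def Z_def V_def D_def q_def x_def z_def)
  define y where "y = x - 1"
  define E where "E = q * (1 - y * z - y * z ^ 2) - y * z * D"
  \<comment> \<open>Now \<open>Z\<close>, \<open>V\<close> and \<open>q * C\<close> are all
    multiples of \<open>W\<close>, so only \<open>W\<close> and \<open>F\<close> remain to be
    related.\<close>
  have Z': "Z = W - y * z * W" using V by (simp add: W_def y_def)
  have "q * Z = q * z * F + y * z * (q * V + q * C)"
    unfolding Z U y_def by (simp add: algebra_simps)
  then have EW: "E * W = q * z * F"
    unfolding Z' V C E_def by (simp add: algebra_simps power2_eq_square)
  have "q * F = q + q * Z + q * B" by (subst F) (simp add: algebra_simps)
  then have "(q - D) * F = q + (q - y * z * q + y * z * D) * W"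
    unfolding Z' V B y_def[symmetric] by (simp add: algebra_simps)
  \<comment> \<open>Multiplying by \<open>E\<close> allows \<open>E * W\<close> to be replaced by
    \<open>q * z * F\<close>, which eliminates \<open>W\<close> without a division.\<close>
  then have "E * (q - D) * F = q * E + (q - y * z * q + y * z * D) * (E * W)"
    by algebra
  then have "(E * (q - D) - (q - y * z * q + y * z * D) * q * z) * F = q * E"
    unfolding EW by algebra
  then show ?thesis unfolding E_def D_def q_def y_def by algebra
qed

section \<open>Extraction of coefficients\<close>

lemma deg_enum_eq_gf_nth: "deg_enum n = gf UNIV $ (n + 2)"
  by (simp add: deg_enum_eq gf_def)

theorem theorem6p8:
  fixes n :: nat
  assumes "n \<ge> 12"
  shows "deg_enum n =
      X * deg_enum (n - 1) + 2 * deg_enum (n - 2) - X * deg_enum (n - 3) - deg_enum (n - 4)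
      + X * (X - 1) * deg_enum (n - 5) - X * (X ^ 2 - 1) * deg_enum (n - 7)
      - 2 * X ^ 2 * (X - 1) ^ 2 * deg_enum (n - 9) - X ^ 2 * (X - 1) ^ 3 * deg_enum (n - 11)"
proof -
  let ?F = "gf UNIV" and ?x = "fps_const X" and ?z = "fps_X :: int poly fps"
  let ?y = "?x - 1" and ?N = "n + 2"
  define P where "P = (1 - ?z ^ 2) * ((1 - ?z ^ 2) * (1 - ?y * ?z - ?y * ?z ^ 2)
      - ?y * ?z * (?x * ?z ^ 3 + ?x * ?y * ?z ^ 5))"
  have nth: "(c * ?z ^ k * G) $ ?N = a * G $ (?N - k)" if "c = fps_const a" "k \<le> ?N" for a c k G
    using that by (simp add: mult.assoc fps_X_power_mult_nth)
  \<comment> \<open>Expanded in powers of \<open>fps_X\<close>, the numerator has degree at most 8,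
    below \<open>n + 2\<close>, so it adds nothing to the coefficient compared. The factors
    \<open>1\<close> fit the pattern of \<open>nth\<close>.\<close>
  have P: "P = 1 * ?z ^ 0 * 1 + (- ?y) * ?z ^ 1 * 1 + (- (?y + 2)) * ?z ^ 2 * 1
      + (2 * ?y) * ?z ^ 3 * 1 + (1 + 2 * ?y - ?x * ?y) * ?z ^ 4 * 1 + (- ?y) * ?z ^ 5 * 1
      + (- ?y - ?x * ?y * (?y - 1)) * ?z ^ 6 * 1 + (?x * ?y ^ 2) * ?z ^ 8 * 1"
    unfolding P_def by algebra
  have y: "?y = fps_const (X - 1)" by (simp flip: fps_const_sub)
  have two: "2 = fps_const (2 :: int poly)" by (simp add: numeral_fps_const)
  note const_simps = y two fps_const_power fps_const_mult fps_const_add fps_const_sub fps_const_neg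
  have "P $ ?N = 1 * 1 $ (?N - 0) + (- (X - 1)) * 1 $ (?N - 1) + (- (X - 1 + 2)) * 1 $ (?N - 2)
      + (2 * (X - 1)) * 1 $ (?N - 3) + (1 + 2 * (X - 1) - X * (X - 1)) * 1 $ (?N - 4)
      + (- (X - 1)) * 1 $ (?N - 5) + (- (X - 1) - X * (X - 1) * (X - 1 - 1)) * 1 $ (?N - 6)
      + (X * (X - 1) ^ 2) * 1 $ (?N - 8)"
    unfolding P fps_add_nth
    using assms
    by (intro arg_cong2[of _ _ _ _ "(+)"] nth) (simp_all only: const_simps flip: fps_const_1_eq_1)
  then have "P $ ?N = 0"
    using assms by (simp only: fps_one_nth) simp
  have "?F = ?x * ?z ^ 1 * ?F + 2 * ?z ^ 2 * ?F - ?x * ?z ^ 3 * ?F - 1 * ?z ^ 4 * ?F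
      + ?x * ?y * ?z ^ 5 * ?F - ?x * (?x ^ 2 - 1) * ?z ^ 7 * ?F
      - 2 * ?x ^ 2 * ?y ^ 2 * ?z ^ 9 * ?F - ?x ^ 2 * ?y ^ 3 * ?z ^ 11 * ?F + P"
    unfolding P_def mult_1 power_one_right by (rule gf_all_equation)
  then have "?F $ ?N = (?x * ?z ^ 1 * ?F + 2 * ?z ^ 2 * ?F - ?x * ?z ^ 3 * ?F - 1 * ?z ^ 4 * ?F
      + ?x * ?y * ?z ^ 5 * ?F - ?x * (?x ^ 2 - 1) * ?z ^ 7 * ?F
      - 2 * ?x ^ 2 * ?y ^ 2 * ?z ^ 9 * ?F - ?x ^ 2 * ?y ^ 3 * ?z ^ 11 * ?F + P) $ ?N"
    by (rule arg_cong)
  also have "\<dots> = X * ?F $ (?N - 1) + 2 * ?F $ (?N - 2) - X * ?F $ (?N - 3) - 1 * ?F $ (?N - 4)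
      + X * (X - 1) * ?F $ (?N - 5) - X * (X ^ 2 - 1) * ?F $ (?N - 7)
      - 2 * X ^ 2 * (X - 1) ^ 2 * ?F $ (?N - 9) - X ^ 2 * (X - 1) ^ 3 * ?F $ (?N - 11)"
    unfolding fps_add_nth fps_sub_nth \<open>P $ ?N = 0\<close> add_0_right
    using assms
    by (intro arg_cong2[of _ _ _ _ "(+)"] arg_cong2[of _ _ _ _ "(-)"] nth)
      (simp_all only: const_simps flip: fps_const_1_eq_1)
  \<comment> \<open>All shifts \<open>k\<close> are at most 11 and \<open>n \<ge> 12\<close>, so
    \<open>(n + 2) - k = (n - k) + 2\<close> holds for natural subtraction.\<close>
  also have "\<dots> = X * deg_enum (n - 1) + 2 * deg_enum (n - 2) - X * deg_enum (n - 3)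
      - 1 * deg_enum (n - 4) + X * (X - 1) * deg_enum (n - 5) - X * (X ^ 2 - 1) * deg_enum (n - 7)
      - 2 * X ^ 2 * (X - 1) ^ 2 * deg_enum (n - 9) - X ^ 2 * (X - 1) ^ 3 * deg_enum (n - 11)"
    unfolding deg_enum_eq_gf_nth
    using assms by (simp only: Nat.add_diff_assoc2)
  finally show ?thesis by (simp only: deg_enum_eq_gf_nth mult_1)
qed

end
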